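(* There exists $n_0$ such that for every integer $n\geq n_0$ the following holds. In the Waiter-Client game on $K_n$, Client has a strategy ensuring that at the end of the game his red graph does not contain two vertex-disjoint stars each having at least $0.499n$ edges.
   Context: In the unbiased Waiter-Client game on $K_n$, the board is the edge set of the complete graph $K_n$. In each round Waiter offers Client two previously unclaimed edges; Client chooses one of them, which he keeps (colored red), and the other goes to Waiter (colored blue). If in the final round only one unclaimed edge remains, it goes to Waiter. *)

theory Defs
  imports Complex_Main
begin

definition Kn_edges :: "nat \<Rightarrow> nat set set" where
  "Kn_edges n = {{i, j} | i j. i < n \<and> j < n \<and> i \<noteq> j}"

definition two_disjoint_big_stars :: "nat \<Rightarrow> nat set set \<Rightarrow> bool" where
  "two_disjoint_big_stars n R \<longleftrightarrow>
     (\<exists>u v Lu Lv. finite Lu \<and> finite Lv \<and> u \<notin> Lu \<and> v \<notin> Lv \<and>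
        (insert u Lu) \<inter> (insert v Lv) = {} \<and>
        (\<forall>x\<in>Lu. {u, x} \<in> R) \<and> (\<forall>x\<in>Lv. {v, x} \<in> R) \<and>
        real (card Lu) \<ge> 0.499 * real n \<and> real (card Lv) \<ge> 0.499 * real n)"

text \<open>client_wins n U R: in the unbiased Waiter-Client game, from the position where
  U is the set of unclaimed edges and R is Client's (red) edge set, Client has a
  strategy ensuring that his final red graph contains no two vertex-disjoint stars
  with at least 0.499 n edges each.  Game rules: while at least two edges are unclaimed,
  Waiter offers any two distinct unclaimed edges and Client keeps one (the other goes to
  Waiter); when at most one unclaimed edge remains, it goes to Waiter and the game ends.
  This is the standard backward-induction (AND-OR) definition of a winning strategy
  for the finite game.\<close>
inductive client_wins :: "nat \<Rightarrow> nat set set \<Rightarrow> nat set set \<Rightarrow> bool" for n where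
  game_end: "card U \<le> 1 \<Longrightarrow> \<not> two_disjoint_big_stars n R \<Longrightarrow> client_wins n U R"
| game_step: "2 \<le> card U \<Longrightarrow>
     (\<forall>e1\<in>U. \<forall>e2\<in>U. e1 \<noteq> e2 \<longrightarrow>
        (\<exists>c\<in>{e1, e2}. client_wins n (U - {e1, e2}) (insert c R)))
     \<Longrightarrow> client_wins n U R"

end

theory Submission
  imports Defs "HOL-Real_Asymp.Real_Asymp"
begin

text \<open>
  Derandomise the following strategy: of two offered edges, Client keeps the one with the smaller
  sum of end points with probability 3/5, independently in all rounds.  For vertices \<open>a < b\<close>, give
  every other vertex \<open>x\<close> the score 2 if \<open>bx\<close> is red, 1 if only \<open>ax\<close> is red, and 0 otherwise; two
  disjoint big stars centred at \<open>a\<close> and \<open>b\<close> force a total score of at least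
  \<open>(1 + 2) \<cdot> 0.499 n = 1.497 n\<close>.  If \<open>ax\<close> and \<open>bx\<close> are offered together, then \<open>ax\<close> has the smaller
  sum, and the expected score of \<open>x\<close> is 1.4; if they are offered in different rounds, it is at most
  \<open>3/5 \<cdot> 2 + 2/5 \<cdot> 3/5 = 1.44\<close>.  Scores of different vertices that are affected by the same round
  are negatively correlated, so the exponential moment of the total score, computed as if every
  unclaimed edge became red independently with probability 3/5, is a supermartingale.  Summed over
  all pairs it is the potential that Client keeps below the danger threshold.
\<close>

text \<open>The expectation of \<open>1.1\<close> to the power of the score of \<open>x\<close>, when \<open>ax\<close> and \<open>bx\<close> are
  independently red with probabilities \<open>p\<close> and \<open>q\<close>.\<close>

definition vertex_weight :: "real \<Rightarrow> real \<Rightarrow> real" where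
  "vertex_weight p q = q * (11/10)^2 + (1 - q) * (1 + p * (1/10))"

text \<open>A product because different \<open>x\<close> involve different edges, which count as
  independent. Leaving \<open>r\<close> arbitrary turns a round into two function updates.\<close>

definition pair_weight :: "nat \<Rightarrow> (nat set \<Rightarrow> real) \<Rightarrow> nat \<Rightarrow> nat \<Rightarrow> real" where
  "pair_weight n r a b = (\<Prod>x\<in>{..<n} - {a, b}. vertex_weight (r {a, x}) (r {b, x}))"

definition potential :: "nat \<Rightarrow> (nat set \<Rightarrow> real) \<Rightarrow> real" where
  "potential n r = (\<Sum>(a, b)\<in>{(a, b). a < b \<and> b < n}. pair_weight n r a b)"

definition red_prob :: "nat set set \<Rightarrow> nat set set \<Rightarrow> nat set \<Rightarrow> real" where
  "red_prob U R e = (if e \<in> R then 1 else if e \<in> U then 3/5 else 0)"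

lemma finite_ordered_pairs: "finite {(a, b). a < b \<and> b < (n::nat)}"
  by (rule finite_subset[of _ "{..<n} \<times> {..<n}"]) auto

lemma finite_Kn_edges: "finite (Kn_edges n)"
  by (rule finite_subset[of _ "Pow {..<n}"]) (auto simp: Kn_edges_def)

lemma red_prob_bounds: "0 \<le> red_prob U R e" "red_prob U R e \<le> 1"
  by (auto simp: red_prob_def)

section \<open>The weight of a single vertex\<close>

lemma vertex_weight_mono:
  assumes "0 \<le> p" "p \<le> p'" "p' \<le> 1" "0 \<le> q" "q \<le> q'" "q' \<le> 1"
  shows "vertex_weight p q \<le> vertex_weight p' q'"
proof -
  have "vertex_weight p q \<le> vertex_weight p' q"
    unfolding vertex_weight_def using assms by (intro add_left_mono mult_left_mono) auto
  also have "vertex_weight p' q \<le> vertex_weight p' q'"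
  proof -
    have "vertex_weight p' q' - vertex_weight p' q = (q' - q) * ((11/10)^2 - 1 - p' * (1/10))"
      by (simp add: vertex_weight_def field_simps)
    moreover have "0 \<le> (q' - q) * ((11/10)^2 - 1 - p' * (1/10))"
      using assms by (intro mult_nonneg_nonneg) (auto simp: power2_eq_square)
    ultimately show ?thesis by linarith
  qed
  finally show ?thesis .
qed

lemma vertex_weight_ge_1:
  assumes "0 \<le> p" "p \<le> 1" "0 \<le> q" "q \<le> 1"
  shows "1 \<le> vertex_weight p q"
  using vertex_weight_mono[of 0 p 0 q] assms by (simp add: vertex_weight_def)

text \<open>\<open>vertex_weight\<close> is affine in each argument, and 3/5 is the mean of 1 and 0
  with weights 3/5 and 2/5. The free values \<open>c\<close> and \<open>d\<close> at
  \<open>f\<close> make the result fit both outcomes of a round, with either offered edge in the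
  role of \<open>e\<close>.\<close>

lemma vertex_weight_reveal:
  fixes r :: "nat set \<Rightarrow> real" and c d :: real
  assumes ab: "a \<noteq> b" and x: "x \<noteq> a" "x \<noteq> b"
    and r: "\<And>g. 0 \<le> r g" "\<And>g. r g \<le> 1" "r e = 3/5"
    and e: "e = {a, x} \<or> e = {b, x}" and f: "f \<noteq> {a, x}" "f \<noteq> {b, x}"
  defines "hi \<equiv> vertex_weight ((r(e := 1, f := c)) {a, x}) ((r(e := 1, f := c)) {b, x})"
    and "lo \<equiv> vertex_weight ((r(e := 0, f := d)) {a, x}) ((r(e := 0, f := d)) {b, x})"
  shows "vertex_weight (r {a, x}) (r {b, x}) = 3/5 * hi + 2/5 * lo" "0 \<le> lo" "lo \<le> hi"
proof -
  have ne: "{a, x} \<noteq> {b, x}" using ab x by (auto simp: doubleton_eq_iff)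
  have "vertex_weight (r {a, x}) (r {b, x}) = 3/5 * hi + 2/5 * lo \<and> 1 \<le> lo \<and> lo \<le> hi"
    using e
  proof
    assume e: "e = {a, x}"
    have "hi = vertex_weight 1 (r {b, x})" "lo = vertex_weight 0 (r {b, x})"
      using ne f by (simp_all add: hi_def lo_def e)
    moreover have "vertex_weight (r {a, x}) (r {b, x})
        = 3/5 * vertex_weight 1 (r {b, x}) + 2/5 * vertex_weight 0 (r {b, x})"
      using r(3)[unfolded e] by (simp only: vertex_weight_def) (simp add: field_simps)
    ultimately show ?thesis
      using r vertex_weight_ge_1[of 0 "r {b, x}"] vertex_weight_mono[of 0 1 "r {b, x}" "r {b, x}"]
      by simp
  next
    assume e: "e = {b, x}"
    have "hi = vertex_weight (r {a, x}) 1" "lo = vertex_weight (r {a, x}) 0"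
      using ne f by (simp_all add: hi_def lo_def e)
    moreover have "vertex_weight (r {a, x}) (r {b, x})
        = 3/5 * vertex_weight (r {a, x}) 1 + 2/5 * vertex_weight (r {a, x}) 0"
      using r(3)[unfolded e] by (simp only: vertex_weight_def) (simp add: field_simps)
    ultimately show ?thesis
      using r vertex_weight_ge_1[of "r {a, x}" 0] vertex_weight_mono[of "r {a, x}" "r {a, x}" 0 1]
      by simp
  qed
  then show "vertex_weight (r {a, x}) (r {b, x}) = 3/5 * hi + 2/5 * lo" "0 \<le> lo" "lo \<le> hi"
    by auto
qed

text \<open>Exactly one offered edge becomes red, so the high value of one vertex meets the low
  value of the other. The right side treats the edges as independent and gives both probability 3/5,
  although the second has only 2/5.\<close>

lemma negative_correlation:
  fixes A A' B B' :: real
  assumes "0 \<le> A'" "A' \<le> A" "B' \<le> B"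
  shows "3/5 * (A * B') + 2/5 * (A' * B) \<le> (3/5 * A + 2/5 * A') * (3/5 * B + 2/5 * B')"
proof -
  have "(3/5 * A + 2/5 * A') * (3/5 * B + 2/5 * B') - (3/5 * (A * B') + 2/5 * (A' * B))
      = (9/25 * A - 4/25 * A') * (B - B')"
    by (simp add: field_simps)
  moreover have "0 \<le> (9/25 * A - 4/25 * A') * (B - B')"
    using assms by (intro mult_nonneg_nonneg) auto
  ultimately show ?thesis by linarith
qed

section \<open>The effect of one round\<close>

lemma pair_weight_step:
  assumes ab: "a < b" and ef: "e \<noteq> f" "\<Sum>e \<le> \<Sum>f"
    and r: "\<And>g. 0 \<le> r g" "\<And>g. r g \<le> 1" "r e = 3/5" "r f = 3/5"
  shows "3/5 * pair_weight n (r(e := 1, f := 0)) a b + 2/5 * pair_weight n (r(e := 0, f := 1)) a b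
         \<le> pair_weight n r a b"
proof -
  define X where "X = {..<n} - {a, b}"
  define k where "k s x = vertex_weight (s {a, x}) (s {b, x})" for s :: "nat set \<Rightarrow> real" and x
  define touch where "touch g x \<longleftrightarrow> g = {a, x} \<or> g = {b, x}" for g and x :: nat
  let ?p = "r(e := 1, f := 0)" and ?q = "r(e := 0, f := 1)"
  have X: "finite X" "\<And>x. x \<in> X \<Longrightarrow> x \<noteq> a \<and> x \<noteq> b"
    by (auto simp: X_def)
  have weight: "pair_weight n s a b = prod (k s) X" for s
    by (simp add: pair_weight_def X_def k_def)
  \<comment> \<open>Each offered edge alters at most one factor, as it has at most one end in
    \<open>X\<close> when it meets \<open>a\<close> or \<open>b\<close>.\<close>
  have unique: "x = y" if "touch g x" "touch g y" "x \<in> X" "y \<in> X" for g x y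
    using that X(2)[of x] X(2)[of y] ab by (auto simp: touch_def doubleton_eq_iff)
  have untouched: "k ?p x = k r x" "k ?q x = k r x" if "\<not> touch e x" "\<not> touch f x" for x
    using that by (auto simp: touch_def k_def)
  have only_e: "k r x = 3/5 * k ?p x + 2/5 * k ?q x" "0 \<le> k ?q x" "k ?q x \<le> k ?p x"
    if x: "x \<in> X" and e: "touch e x" and f: "\<not> touch f x" for x
  proof -
    have "a \<noteq> b" "x \<noteq> a" "x \<noteq> b" "e = {a, x} \<or> e = {b, x}" "f \<noteq> {a, x}" "f \<noteq> {b, x}"
      using ab X(2)[OF x] e f by (simp_all add: touch_def)
    note reveal = vertex_weight_reveal[where r = r, OF this(1-3) r(1-3) this(4-6)]
    show "k r x = 3/5 * k ?p x + 2/5 * k ?q x" "0 \<le> k ?q x" "k ?q x \<le> k ?p x"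
      unfolding k_def by (rule reveal)+
  qed
  have only_f: "k r x = 3/5 * k ?q x + 2/5 * k ?p x" "0 \<le> k ?p x" "k ?p x \<le> k ?q x"
    if x: "x \<in> X" and f: "touch f x" and e: "\<not> touch e x" for x
  proof -
    have "a \<noteq> b" "x \<noteq> a" "x \<noteq> b" "f = {a, x} \<or> f = {b, x}" "e \<noteq> {a, x}" "e \<noteq> {b, x}"
      using ab X(2)[OF x] e f by (simp_all add: touch_def)
    note reveal = vertex_weight_reveal[where r = r, OF this(1-3) r(1,2,4) this(4-6)]
    show "k r x = 3/5 * k ?q x + 2/5 * k ?p x" "0 \<le> k ?p x" "k ?p x \<le> k ?q x"
      unfolding k_def fun_upd_twist[OF ef(1)] by (rule reveal)+
  qed
  have both: "3/5 * k ?p x + 2/5 * k ?q x \<le> k r x"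
    if "x \<in> X" "touch e x" "touch f x" for x
  proof -
    \<comment> \<open>The two sums differ by \<open>b - a\<close>, so the smaller one belongs to the
      edge at \<open>a\<close>.\<close>
    have e: "e = {a, x}" and f: "f = {b, x}"
      using that X(2)[of x] ab ef by (auto simp: touch_def)
    have "k ?p x = vertex_weight 1 0" "k ?q x = vertex_weight 0 1" "k r x = vertex_weight (3/5) (3/5)"
      using ef(1) by (simp_all add: k_def r(3,4)[unfolded e f] e f)
    \<comment> \<open>The mean is 0.6 * 1.1 + 0.4 * 1.21 = 1.144, against 1.15; the opposite
      preference would give 1.166.\<close>
    then show ?thesis by (simp add: vertex_weight_def power2_eq_square)
  qed
  have nonneg: "0 \<le> k r x" for x
    using vertex_weight_ge_1[of "r {a, x}" "r {b, x}"] r by (simp add: k_def)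
  have one: "3/5 * prod (k ?p) X + 2/5 * prod (k ?q) X \<le> prod (k r) X"
    if x: "x \<in> X" "3/5 * k ?p x + 2/5 * k ?q x \<le> k r x"
      and others: "\<And>y. y \<in> X \<Longrightarrow> y \<noteq> x \<Longrightarrow> \<not> touch e y \<and> \<not> touch f y" for x
  proof -
    have split: "prod (k s) X = k s x * prod (k s) (X - {x})" for s
      using X(1) x(1) by (rule prod.remove)
    have "prod (k ?p) (X - {x}) = prod (k r) (X - {x})" "prod (k ?q) (X - {x}) = prod (k r) (X - {x})"
      using others untouched by (auto intro!: prod.cong)
    then show ?thesis
      using mult_right_mono[OF x(2), of "prod (k r) (X - {x})"] prod_nonneg[of "X - {x}" "k r"] nonneg
      by (simp add: split algebra_simps)
  qed
  consider
    (none) "\<And>x. x \<in> X \<Longrightarrow> \<not> touch e x \<and> \<not> touch f x"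
    | (e) x where "x \<in> X" "touch e x" "\<And>y. y \<in> X \<Longrightarrow> \<not> touch f y"
    | (f) x where "x \<in> X" "touch f x" "\<And>y. y \<in> X \<Longrightarrow> \<not> touch e y"
    | (same) x where "x \<in> X" "touch e x" "touch f x"
    | (different) x y where "x \<in> X" "y \<in> X" "x \<noteq> y" "touch e x" "touch f y"
    by metis
  then have "3/5 * prod (k ?p) X + 2/5 * prod (k ?q) X \<le> prod (k r) X"
  proof cases
    case none
    then have "prod (k ?p) X = prod (k r) X" "prod (k ?q) X = prod (k r) X"
      using untouched by (auto intro!: prod.cong)
    then show ?thesis by simp
  next
    case (e x)
    then show ?thesis using one[of x] only_e[of x] unique by fastforce
  next
    case (f x)
    \<comment> \<open>Now the high value has weight only 2/5, so the mean is at most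
      \<open>k r x\<close>, where it has weight 3/5.\<close>
    then show ?thesis using one[of x] only_f[of x] unique by fastforce
  next
    case (same x)
    then show ?thesis using one[of x] both[of x] unique by blast
  next
    case (different x y)
    define Y where "Y = X - {x} - {y}"
    have nt: "\<not> touch f x" "\<not> touch e y" and ntY: "\<And>z. z \<in> Y \<Longrightarrow> \<not> touch e z \<and> \<not> touch f z"
      using different unique unfolding Y_def by blast+
    have split: "prod (k s) X = k s x * k s y * prod (k s) Y" for s
      using X(1) different prod.remove[of X x "k s"] prod.remove[of "X - {x}" y "k s"]
      by (simp add: Y_def)
    have "prod (k ?p) Y = prod (k r) Y" "prod (k ?q) Y = prod (k r) Y"
      using ntY untouched by (auto intro!: prod.cong)
    moreover have "3/5 * (k ?p x * k ?p y) + 2/5 * (k ?q x * k ?q y) \<le> k r x * k r y"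
      using only_e[of x] only_f[of y] different nt
        negative_correlation[of "k ?q x" "k ?p x" "k ?p y" "k ?q y"] by simp
    from mult_right_mono[OF this, of "prod (k r) Y"]
    have "3/5 * (k ?p x * k ?p y * prod (k r) Y) + 2/5 * (k ?q x * k ?q y * prod (k r) Y)
        \<le> k r x * k r y * prod (k r) Y"
      using prod_nonneg[of Y "k r"] nonneg by (simp add: algebra_simps)
    ultimately show ?thesis by (simp add: split)
  qed
  then show ?thesis by (simp add: weight)
qed

text \<open>Some outcome is no larger than the weighted mean; this makes the random choice
  deterministic.\<close>

lemma potential_step:
  assumes "e \<noteq> f" "\<Sum>e \<le> \<Sum>f"
    and "\<And>g. 0 \<le> r g" "\<And>g. r g \<le> 1" "r e = 3/5" "r f = 3/5"
  shows "potential n (r(e := 1, f := 0)) \<le> potential n r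
       \<or> potential n (r(e := 0, f := 1)) \<le> potential n r"
proof -
  have "3/5 * potential n (r(e := 1, f := 0)) + 2/5 * potential n (r(e := 0, f := 1))
      \<le> potential n r"
    unfolding potential_def sum_distrib_left sum.distrib[symmetric]
    using pair_weight_step[OF _ assms] by (intro sum_mono) (auto simp: split_beta)
  then show ?thesis by linarith
qed

section \<open>Big stars force a large potential\<close>

lemma pair_weight_ge_big_stars:
  assumes r: "\<And>g. 0 \<le> r g" "\<And>g. r g \<le> 1"
    and sub: "A \<subseteq> {..<n} - {a, b}" "B \<subseteq> {..<n} - {a, b}" "A \<inter> B = {}"
    and red: "\<And>x. x \<in> A \<Longrightarrow> r {a, x} = 1" "\<And>x. x \<in> B \<Longrightarrow> r {b, x} = 1"
  shows "(11/10) ^ (card A + 2 * card B) \<le> pair_weight n r a b"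
proof -
  define k where "k x = vertex_weight (r {a, x}) (r {b, x})" for x
  have fin: "finite A" "finite B" using sub finite_subset by blast+
  have k1: "1 \<le> k x" for x using vertex_weight_ge_1 r by (simp add: k_def)
  \<comment> \<open>The bound is \<open>vertex_weight 1 0\<close>, the least possible value once
    \<open>{a, x}\<close> is red.\<close>
  have "11/10 \<le> k x" if "x \<in> A" for x
    using vertex_weight_mono[of 1 1 0 "r {b, x}"] r red(1)[OF that]
    by (simp add: k_def vertex_weight_def)
  then have A: "(11/10) ^ card A \<le> prod k A"
    using prod_mono[of A "\<lambda>_. 11/10" k] by simp
  have "k x = (11/10)^2" if "x \<in> B" for x
    using red(2)[OF that] by (simp add: k_def vertex_weight_def)
  then have B: "(11/10) ^ (2 * card B) = prod k B"
    by (simp add: power_mult)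
  have "(11/10) ^ (card A + 2 * card B) \<le> prod k A * prod k B"
    unfolding power_add B using A B[symmetric] by (intro mult_right_mono) auto
  also have "\<dots> = prod k (A \<union> B)"
    using fin sub(3) by (simp add: prod.union_disjoint)
  also have "\<dots> \<le> prod k ({..<n} - {a, b})"
    using sub k1 order.trans[OF zero_le_one k1] by (intro prod_mono2) auto
  finally show ?thesis by (simp add: pair_weight_def k_def)
qed

lemma pair_weight_le_potential:
  assumes "a < b" "b < n" and r: "\<And>g. 0 \<le> r g" "\<And>g. r g \<le> 1"
  shows "pair_weight n r a b \<le> potential n r"
proof -
  have "0 \<le> pair_weight n r c d" for c d
    unfolding pair_weight_def
    using r by (intro prod_nonneg) (auto intro: order.trans[OF zero_le_one vertex_weight_ge_1])
  then show ?thesis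
    unfolding potential_def
    using member_le_sum[of "(a, b)" _ "\<lambda>(a, b). pair_weight n r a b", OF _ _ finite_ordered_pairs] assms(1,2)
    by (auto simp: split_beta)
qed

lemma big_stars_imp_potential_large:
  assumes "two_disjoint_big_stars n R" "R \<subseteq> Kn_edges n" "0 < n"
  shows "(11/10) powr (1.497 * real n) \<le> potential n (red_prob U R)"
proof -
  have wlog: ?thesis
    if "u < v" and disj: "insert u A \<inter> insert v B = {}"
      and red: "\<forall>x\<in>A. {u, x} \<in> R" "\<forall>x\<in>B. {v, x} \<in> R"
      and card: "0.499 * real n \<le> real (card A)" "0.499 * real n \<le> real (card B)"
    for u v A B
  proof -
    have inA: "u < n \<and> x < n \<and> x \<noteq> u" if "x \<in> A" for x
      using red(1) that assms(2) by (force simp: Kn_edges_def doubleton_eq_iff)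
    have inB: "v < n \<and> x < n \<and> x \<noteq> v" if "x \<in> B" for x
      using red(2) that assms(2) by (force simp: Kn_edges_def doubleton_eq_iff)
    \<comment> \<open>A centre without leaves could lie outside the graph; a red edge at
      \<open>v\<close> places it below \<open>n\<close>.\<close>
    have "B \<noteq> {}" using card(2) assms(3) by auto
    then have "v < n" using inB by blast
    have "(11/10) powr (1.497 * real n) \<le> (11/10) powr real (card A + 2 * card B)"
      using card by (intro powr_mono) auto
    also have "\<dots> = (11/10) ^ (card A + 2 * card B)"
      by (rule powr_realpow) simp
    also have "\<dots> \<le> pair_weight n (red_prob U R) u v"
      using inA inB disj red
      by (intro pair_weight_ge_big_stars red_prob_bounds) (auto simp: red_prob_def)
    also have "\<dots> \<le> potential n (red_prob U R)"
      using \<open>u < v\<close> \<open>v < n\<close> by (intro pair_weight_le_potential red_prob_bounds)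
    finally show ?thesis .
  qed
  obtain u v A B where *: "insert u A \<inter> insert v B = {}"
    "\<forall>x\<in>A. {u, x} \<in> R" "\<forall>x\<in>B. {v, x} \<in> R"
    "0.499 * real n \<le> real (card A)" "0.499 * real n \<le> real (card B)"
    using assms(1) unfolding two_disjoint_big_stars_def by blast
  then consider "u < v" | "v < u" by fastforce
  then show ?thesis
  proof cases
    case 1
    then show ?thesis using wlog * by blast
  next
    case 2
    then show ?thesis using wlog[of v u B A] * by (auto simp: Int_commute)
  qed
qed

section \<open>Client's strategy\<close>

lemma client_wins_if_potential_small:
  assumes "0 < n" "finite U" "U \<inter> R = {}" "U \<union> R \<subseteq> Kn_edges n"
    and "potential n (red_prob U R) < (11/10) powr (1.497 * real n)"
  shows "client_wins n U R"
  using assms(2-)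
proof (induction "card U" arbitrary: U R rule: less_induct)
  case less
  show ?case
  proof (cases "card U \<le> 1")
    case True
    then show ?thesis
      \<comment> \<open>A last unclaimed edge still counts with probability 3/5, which is harmless:
        the lower bound rests on red edges alone and holds for any \<open>U\<close>.\<close>
      using less.prems assms(1) big_stars_imp_potential_large[of n R U]
      by (intro client_wins.game_end) auto
  next
    case False
    have keep: "client_wins n (U - {c, d}) (insert c R)"
      if "c \<in> U" "d \<in> U" "c \<noteq> d"
        and "potential n ((red_prob U R)(c := 1, d := 0)) \<le> potential n (red_prob U R)" for c d
    proof -
      have "red_prob (U - {c, d}) (insert c R) = (red_prob U R)(c := 1, d := 0)"
        using that less.prems(2) by (auto simp: red_prob_def fun_eq_iff)
      moreover have "card (U - {c, d}) < card U"
        using that less.prems(1) by (intro psubset_card_mono) auto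
      ultimately show ?thesis
        using that less.prems by (intro less.hyps) auto
    qed
    \<comment> \<open>The order of the sums only decides which outcome has weight 3/5 in the mean;
      Client keeps an edge whose outcome does not raise the potential.\<close>
    have choice: "client_wins n (U - {c, d}) (insert c R) \<or> client_wins n (U - {c, d}) (insert d R)"
      if "c \<in> U" "d \<in> U" "c \<noteq> d" "\<Sum>c \<le> \<Sum>d" for c d
    proof -
      have "red_prob U R c = 3/5" "red_prob U R d = 3/5"
        using that less.prems(2) by (auto simp: red_prob_def)
      then show ?thesis
        using potential_step[of c d "red_prob U R" n] that keep[of c d] keep[of d c] red_prob_bounds
        by (auto simp: fun_upd_twist insert_commute)
    qed
    have "\<exists>c\<in>{e, f}. client_wins n (U - {e, f}) (insert c R)"
      if "e \<in> U" "f \<in> U" "e \<noteq> f" for e f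
      using choice[of e f] choice[of f e] that linear[of "\<Sum>e" "\<Sum>f"]
      by (auto simp: insert_commute)
    then show ?thesis
      using False by (intro client_wins.game_step) auto
  qed
qed

section \<open>The initial potential\<close>

lemma potential_start_le:
  "potential n (red_prob (Kn_edges n) {}) \<le> real n ^ 2 * (23/20) ^ n"
proof -
  \<comment> \<open>23/20 is \<open>vertex_weight (3/5) (3/5)\<close>; sets that are not edges have
    probability 0, so monotonicity covers them.\<close>
  have weight: "vertex_weight (red_prob (Kn_edges n) {} g) (red_prob (Kn_edges n) {} h) \<le> 23/20" for g h
    using vertex_weight_mono[of "red_prob (Kn_edges n) {} g" "3/5" "red_prob (Kn_edges n) {} h" "3/5"]
    by (simp add: vertex_weight_def red_prob_def power2_eq_square split: if_splits)
  have "pair_weight n (red_prob (Kn_edges n) {}) a b \<le> (23/20) ^ n" for a b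
  proof -
    have "pair_weight n (red_prob (Kn_edges n) {}) a b \<le> (\<Prod>x\<in>{..<n} - {a, b}. 23/20)"
      unfolding pair_weight_def
      using weight by (intro prod_mono)
        (auto intro: order.trans[OF zero_le_one vertex_weight_ge_1] red_prob_bounds)
    also have "\<dots> \<le> (23/20) ^ n"
      using card_mono[of "{..<n}" "{..<n} - {a, b}"] by (auto intro!: power_increasing)
    finally show ?thesis .
  qed
  then have "potential n (red_prob (Kn_edges n) {})
      \<le> real (card {(a, b). a < b \<and> b < n}) * (23/20) ^ n"
    unfolding potential_def by (intro sum_bounded_above) auto
  also have "card {(a, b). a < b \<and> b < n} \<le> card ({..<n} \<times> {..<n})"
    by (intro card_mono) auto
  then have "real (card {(a, b). a < b \<and> b < n}) * (23/20) ^ n \<le> real n ^ 2 * (23/20) ^ n"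
    by (intro mult_right_mono) (auto simp: power2_eq_square simp flip: of_nat_mult)
  finally show ?thesis .
qed

lemma start_below_threshold:
  "eventually (\<lambda>n. real n ^ 2 * (23/20) ^ n < (11/10) powr (1.497 * real n)) sequentially"
proof -
  \<comment> \<open>The logarithm of 23/20 to base 11/10 is about 1.466, and 37/25 = 1.48 is a
    rational bound above it. A base close to 1 keeps this logarithm close to the mean score
    1.44.\<close>
  have base: "23/20 \<le> (11/10::real) powr (37/25)"
  proof -
    have "(23/20::real) ^ 25 \<le> (11/10) ^ 37" by (simp add: power_divide)
    also have "\<dots> = ((11/10) powr (37/25)) ^ 25"
      by (simp add: powr_power)
    finally show ?thesis by (rule power_mono_iff[THEN iffD1, rotated -1]) auto
  qed
  \<comment> \<open>The slack 0.017 = 1.497 - 1.48 in the exponent absorbs the number of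
    pairs.\<close>
  have "eventually (\<lambda>n. real n ^ 2 < (11/10) powr (0.017 * real n)) sequentially"
    by real_asymp
  then show ?thesis
  proof (rule eventually_mono)
    fix n :: nat
    assume n: "real n ^ 2 < (11/10) powr (0.017 * real n)"
    have "real n ^ 2 * (23/20) ^ n \<le> real n ^ 2 * ((11/10) powr (37/25)) ^ n"
      using base by (intro mult_left_mono power_mono) auto
    also have "\<dots> = real n ^ 2 * (11/10) powr (37/25 * real n)"
      by (simp add: powr_power mult.commute)
    also have "\<dots> < (11/10) powr (0.017 * real n) * (11/10) powr (37/25 * real n)"
      using n by (intro mult_strict_right_mono) auto
    also have "\<dots> = (11/10) powr (1.497 * real n)"
      by (simp flip: powr_add)
    finally show "real n ^ 2 * (23/20) ^ n < (11/10) powr (1.497 * real n)" .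
  qed
qed

theorem theorem5p1:
  shows "\<exists>n0::nat. \<forall>n\<ge>n0. client_wins n (Kn_edges n) {}"
proof -
  have "eventually (\<lambda>n. client_wins n (Kn_edges n) {}) sequentially"
    using start_below_threshold eventually_gt_at_top[of 0]
  proof eventually_elim
    case (elim n)
    then show ?case
      using potential_start_le[of n] finite_Kn_edges[of n]
      by (intro client_wins_if_potential_small) auto
  qed
  then show ?thesis by (simp add: eventually_sequentially)
qed

end
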